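(* Let $f:\mathbb{R}^d\to\mathbb{R}$ be $C^2$ and $\ell$-gradient Lipschitz, let $g_0$ be an $(L,B,c)$-well-behaved function for $f$ with parameters $\eta,\beta>0$, and let $X_f^*$ be the set of strict saddle points of $f$. If $\eta<\frac1L$ and $\beta<\frac1B$, then for every $h_0\in\mathbb{R}$, $$\mu\left(\left\{\mathbf{x}_0\in\mathbb{R}^d:\ \lim_{k\to\infty}\mathbf{x}_k\in X_f^*\right\}\right)=0,$$ where $\mu$ is Lebesgue measure on $\mathbb{R}^d$ and $(\mathbf{x}_k,h_k)$ are the iterates of $g_0$ started from $(\mathbf{x}_0,h_0)$.
   Context: $f$ is $\ell$-gradient Lipschitz if $\|\nabla f(\mathbf{x})-\nabla f(\mathbf{y})\|\le \ell\|\mathbf{x}-\mathbf{y}\|$ for all $\mathbf{x},\mathbf{y}\in\mathbb{R}^d$ ($\|\cdot\|$ is the Euclidean norm). A strict saddle point of $f$ is a point $\mathbf{x}$ with $\nabla f(\mathbf{x})=0$ and $\lambda_{\min}(\nabla^2 f(\mathbf{x}))<0$ (minimum eigenvalue). Dynamical system: for $\eta,\beta>0$, $q_x:\mathbb{R}^d\times\mathbb{R}\to\mathbb{R}^d$ and $q_h:\mathbb{R}\to\mathbb{R}$, let $g_0(\mathbf{x},h)=(\mathbf{x}-\eta\, q_x(\mathbf{x},h),\ \beta\, q_h(h))$ on $\mathbb{R}^{d+1}$, with iterates $(\mathbf{x}_{k+1},h_{k+1})=g_0(\mathbf{x}_k,h_k)$. For a $C^2$, $\ell$-gradient Lipschitz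 $f$, a map $g_0$ of this form is $(L,B,c)$-well-behaved (for $f$) if: (i) $q_x,q_h\in C^1$ and $q_h(0)=0$; (ii) for all $h\in\mathbb{R}$, $q_x(\cdot,h)$ is $L$-Lipschitz and $0<\frac{\partial q_h(h)}{\partial h}\le B$; (iii) for all $(\mathbf{x},h)\in\mathbb{R}^{d+1}$, $\|q_x(\mathbf{x},h)-\nabla f(\mathbf{x})\|\le c|h|$. *)

theory Defs
  imports "HOL-Analysis.Analysis"
begin

definition C1 :: "('a::real_normed_vector \<Rightarrow> 'b::real_normed_vector) \<Rightarrow> bool" where
  "C1 f \<longleftrightarrow> (\<exists>f' :: 'a \<Rightarrow> 'a \<Rightarrow>\<^sub>L 'b.
     (\<forall>x. (f has_derivative blinfun_apply (f' x)) (at x)) \<and> continuous_on UNIV f')"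

definition gradient :: "('a::real_inner \<Rightarrow> real) \<Rightarrow> 'a \<Rightarrow> 'a" where
  "gradient f x = (THE D. GDERIV f x :> D)"

(* A real-valued function on R^d is C2 iff it is C1 with C1 gradient field. *)
definition C2 :: "('a::real_inner \<Rightarrow> real) \<Rightarrow> bool" where
  "C2 f \<longleftrightarrow> C1 f \<and> C1 (gradient f)"

definition hessian :: "(real^'n \<Rightarrow> real) \<Rightarrow> real^'n \<Rightarrow> real^'n^'n" where
  "hessian f x = jacobian (gradient f) (at x)"

definition eigenvalues :: "real^'n^'n \<Rightarrow> real set" where
  "eigenvalues A = {r. \<exists>v. v \<noteq> 0 \<and> A *v v = r *\<^sub>R v}"

(* Meaningful for symmetric A, whose set of real eigenvalues is finite and nonempty. *)
definition lambda_min :: "real^'n^'n \<Rightarrow> real" where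
  "lambda_min A = Min (eigenvalues A)"

definition strict_saddles :: "(real^'n \<Rightarrow> real) \<Rightarrow> (real^'n) set" where
  "strict_saddles f = {x. gradient f x = 0 \<and> lambda_min (hessian f x) < 0}"

definition g0 :: "real \<Rightarrow> real \<Rightarrow> ('a::real_vector \<times> real \<Rightarrow> 'a) \<Rightarrow> (real \<Rightarrow> real) \<Rightarrow>
    'a \<times> real \<Rightarrow> 'a \<times> real" where
  "g0 \<eta> \<beta> q\<^sub>x q\<^sub>h = (\<lambda>(x, h). (x - \<eta> *\<^sub>R q\<^sub>x (x, h), \<beta> * q\<^sub>h h))"

(* For \<eta>, \<beta> > 0 the map g0 \<eta> \<beta> q\<^sub>x q\<^sub>h determines q\<^sub>x and q\<^sub>h, and none of the conditions
   involves \<eta> or \<beta>; the property is therefore stated for the pair (q\<^sub>x, q\<^sub>h). *)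
definition well_behaved :: "real \<Rightarrow> real \<Rightarrow> real \<Rightarrow> ('a::real_inner \<Rightarrow> real) \<Rightarrow>
    ('a \<times> real \<Rightarrow> 'a) \<Rightarrow> (real \<Rightarrow> real) \<Rightarrow> bool" where
  "well_behaved L B c f q\<^sub>x q\<^sub>h \<longleftrightarrow>
     C1 q\<^sub>x \<and> C1 q\<^sub>h \<and> q\<^sub>h 0 = 0 \<and>
     (\<forall>h. L-lipschitz_on UNIV (\<lambda>x. q\<^sub>x (x, h)) \<and> 0 < deriv q\<^sub>h h \<and> deriv q\<^sub>h h \<le> B) \<and>
     (\<forall>x h. norm (q\<^sub>x (x, h) - gradient f x) \<le> c * \<bar>h\<bar>)"

end

(*
  The h-component evolves autonomously and tends to 0, so the x-component is a non-autonomous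
  orbit x_{k+1} = T_k x_k, where near a strict saddle p the map T_k is, for large k, a small
  Lipschitz perturbation of A = I - eta * Hess f(p). Here A is symmetric and, as eta * L < 1,
  positive definite, and the negative curvature gives it an eigenvector v with eigenvalue a > 1.

  No invariant manifold is constructed. For gamma in (1, a) that is not an eigenvalue, the
  quadratic form of A - gamma grows by the factor gamma^2 along differences of orbits that stay
  near p, and it is positive on v. Hence two such orbits cannot start from points differing by a
  nonzero multiple of v. So the compact set of points whose orbit stays near p has pairwise
  disjoint translates by v / n, which makes it a null set. Since eta * L < 1, every T_k has a
  Lipschitz inverse on its image, so null sets pull back to null sets, and by the Lindeloef
  property countably many saddles suffice.
*)

theory Submission
  imports Defs
begin

section \<open>Null sets from disjoint translates\<close>

text \<open>Infinitely many pairwise disjoint translates of \<open>S\<close>, all of the same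
  measure, fit into one ball of finite measure, so that measure is 0. Hypothesis \<open>inj\<close>
  makes every line in direction \<open>v\<close> meet \<open>S\<close> at most once.\<close>

lemma negligible_disjoint_translates:
  fixes S :: "'a::euclidean_space set"
  assumes S: "compact S" and v: "v \<noteq> 0"
    and inj: "\<And>x t. x \<in> S \<Longrightarrow> x + t *\<^sub>R v \<in> S \<Longrightarrow> t = 0"
  shows "negligible S"
proof -
  \<comment> \<open>The shifts are distinct, which with \<open>inj\<close> gives disjointness, and
    their factors lie in (0, 1], which keeps every translate in the ball of radius
    \<open>R + norm v\<close>.\<close>
  define F where "F i = (+) ((1 / (1 + real i)) *\<^sub>R v) ` S" for i :: nat
  obtain R where R: "\<And>x. x \<in> S \<Longrightarrow> norm x \<le> R"
    using S compact_imp_bounded bounded_iff by metis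
  have F: "F i \<in> lmeasurable" for i
    unfolding F_def by (intro lmeasurable_compact compact_translation S)
  have disj: "disjnt (F i) (F j)" if "i \<noteq> j" for i j
  proof -
    have False if "x \<in> S" "y \<in> S"
      "(1 / (1 + real i)) *\<^sub>R v + x = (1 / (1 + real j)) *\<^sub>R v + y" for x y
    proof -
      have "x + (1 / (1 + real i) - 1 / (1 + real j)) *\<^sub>R v = y"
        using that(3) by (simp add: algebra_simps)
      then have "1 / (1 + real i) - 1 / (1 + real j) = 0"
        using inj that by metis
      then have "inverse (1 + real i) = inverse (1 + real j)"
        by (simp add: inverse_eq_divide)
      then show False using \<open>i \<noteq> j\<close> by simp
    qed
    then show ?thesis unfolding F_def disjnt_def by auto
  qed
  have "real n * measure lebesgue S \<le> measure lebesgue (cball (0::'a) (R + norm v))" for n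
  proof -
    have "real n * measure lebesgue S = (\<Sum>i<n. measure lebesgue (F i))"
      unfolding F_def by (simp add: measure_translation)
    also have "\<dots> = measure lebesgue (\<Union>i<n. F i)"
      by (intro measure_UNION'[symmetric]) (auto simp: F pairwise_def disj)
    also have "\<dots> \<le> measure lebesgue (cball (0::'a) (R + norm v))"
    proof (rule measure_mono_fmeasurable)
      show "(\<Union>i<n. F i) \<subseteq> cball 0 (R + norm v)"
      proof clarsimp
        fix x i assume "x \<in> F i"
        then obtain y where y: "y \<in> S" "x = (1 / (1 + real i)) *\<^sub>R v + y"
          unfolding F_def by auto
        have "norm ((1 / (1 + real i)) *\<^sub>R v) \<le> 1 * norm v"
          unfolding norm_scaleR by (intro mult_right_mono) auto
        then show "norm x \<le> R + norm v"
          using norm_triangle_ineq[of "(1 / (1 + real i)) *\<^sub>R v" y] R[OF y(1)] y(2) by simp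
      qed
    qed (use F in \<open>auto intro!: fmeasurableD\<close>)
    finally show ?thesis .
  qed
  then have "\<not> measure lebesgue S > 0"
    using reals_Archimedean3 by (metis not_le)
  then show ?thesis
    using lmeasurable_compact[OF S] by (simp add: negligible_iff_measure order_less_le)
qed

section \<open>Spectral facts for symmetric operators\<close>

text \<open>A nonnegative quadratic form is minimal wherever it vanishes, so its gradient, twice
  \<open>A w\<close>, is zero there. The proof tests this along the direction
  \<open>- A w\<close>.\<close>

lemma symmetric_psd_zero:
  fixes A :: "'a::real_inner \<Rightarrow> 'a"
  assumes A: "linear A" and sym: "\<And>x y. A x \<bullet> y = x \<bullet> A y"
    and psd: "\<And>x. 0 \<le> A x \<bullet> x" and w: "A w \<bullet> w = 0"
  shows "A w = 0"
proof -
  define r where "r = A w"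
  have *: "2 * (r \<bullet> r) \<le> s * (A r \<bullet> r)" if "s > 0" for s
  proof -
    have "0 \<le> A (w - s *\<^sub>R r) \<bullet> (w - s *\<^sub>R r)" by (rule psd)
    also have "\<dots> = s * (s * (A r \<bullet> r) - 2 * (r \<bullet> r))"
      using w sym[of r w]
      by (simp add: linear_diff[OF A] linear_cmul[OF A] inner_diff inner_commute
          flip: r_def) (simp add: algebra_simps)
    finally show ?thesis using that by (simp add: zero_le_mult_iff)
  qed
  have "r \<bullet> r \<le> 0"
  proof (rule ccontr)
    assume "\<not> r \<bullet> r \<le> 0"
    then have "r \<bullet> r > 0" by linarith
    have "2 * (r \<bullet> r) \<le> A r \<bullet> r" using *[of 1] by simp
    with \<open>r \<bullet> r > 0\<close> have "A r \<bullet> r > 0" by linarith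
    \<comment> \<open>With \<open>s\<close> equal to
      \<open>(r \<bullet> r) / (A r \<bullet> r)\<close> the right-hand side of \<open>*\<close>
      becomes \<open>r \<bullet> r\<close>.\<close>
    then have "2 * (r \<bullet> r) \<le> r \<bullet> r"
      using *[of "(r \<bullet> r) / (A r \<bullet> r)"] \<open>r \<bullet> r > 0\<close> by simp
    with \<open>r \<bullet> r > 0\<close> show False by simp
  qed
  then show ?thesis by (metis r_def inner_eq_zero_iff inner_ge_zero order_antisym)
qed

text \<open>A maximizer \<open>w\<close> of the quadratic form on the unit sphere is an eigenvector
  for the maximum \<open>m\<close>: by homogeneity \<open>m *\<^sub>R x - A x\<close> is positive
  semidefinite in \<open>x\<close>, and its form vanishes at \<open>w\<close>.\<close>

lemma symmetric_has_eigenvector: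
  fixes A :: "'a::euclidean_space \<Rightarrow> 'a"
  assumes A: "linear A" and sym: "\<And>x y. A x \<bullet> y = x \<bullet> A y"
  shows "\<exists>r v. v \<noteq> 0 \<and> A v = r *\<^sub>R v"
proof -
  have "compact (sphere (0::'a) 1)" "sphere (0::'a) 1 \<noteq> {}" by auto
  moreover have "continuous_on (sphere 0 1) (\<lambda>x. A x \<bullet> x)"
    using A by (intro continuous_intros linear_continuous_on linear_conv_bounded_linear[THEN iffD1])
  ultimately obtain w where w: "norm w = 1" and le: "\<And>x. norm x = 1 \<Longrightarrow> A x \<bullet> x \<le> A w \<bullet> w"
    using continuous_attains_sup[of "sphere (0::'a) 1" "\<lambda>x. A x \<bullet> x"] by (auto simp: dist_norm)
  define m where "m = A w \<bullet> w"
  have "m *\<^sub>R w - A w = 0"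
  proof (rule symmetric_psd_zero[of "\<lambda>x. m *\<^sub>R x - A x"])
    show "linear (\<lambda>x. m *\<^sub>R x - A x)"
      using A by (intro linear_compose_sub linear_compose_scale_right linear_id[unfolded id_def])
    show "0 \<le> (m *\<^sub>R x - A x) \<bullet> x" for x
    proof (cases "x = 0")
      case False
      have "A (x /\<^sub>R norm x) \<bullet> (x /\<^sub>R norm x) \<le> m"
        unfolding m_def using False by (intro le) simp
      then show ?thesis using False
        by (simp add: linear_cmul[OF A] inner_diff power2_norm_eq_inner[symmetric] field_simps
            power2_eq_square)
    qed simp
    show "(m *\<^sub>R w - A w) \<bullet> w = 0"
      using w by (simp add: inner_diff m_def power2_norm_eq_inner[symmetric])
  qed (simp add: inner_diff sym)
  then show ?thesis using w by (metis eq_iff_diff_eq_0 norm_zero zero_neq_one)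
qed

text \<open>Eigenvectors for distinct eigenvalues are orthogonal, and a pairwise orthogonal set in a
  Euclidean space is finite. Choosing one eigenvector per eigenvalue is injective.\<close>

lemma symmetric_finite_eigenvalues:
  fixes A :: "'a::euclidean_space \<Rightarrow> 'a"
  assumes sym: "\<And>x y. A x \<bullet> y = x \<bullet> A y"
  shows "finite {r. \<exists>v. v \<noteq> 0 \<and> A v = r *\<^sub>R v}" (is "finite ?E")
proof -
  obtain v where v: "\<And>r. r \<in> ?E \<Longrightarrow> v r \<noteq> 0 \<and> A (v r) = r *\<^sub>R v r"
    using bchoice[of ?E "\<lambda>r v. v \<noteq> 0 \<and> A v = r *\<^sub>R v"] by auto
  have orth: "v r \<bullet> v s = 0" if "r \<in> ?E" "s \<in> ?E" "r \<noteq> s" for r s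
    using sym[of "v r" "v s"] v[OF that(1)] v[OF that(2)] that(3) by auto
  have "pairwise orthogonal (v ` ?E)"
    using orth by (fastforce simp: pairwise_def orthogonal_def)
  then have "finite (v ` ?E)" by (rule pairwise_orthogonal_imp_finite)
  moreover have "inj_on v ?E"
    using orth v by (metis (no_types, lifting) inj_onI inner_eq_zero_iff)
  ultimately show ?thesis by (rule finite_imageD)
qed

section \<open>Gradients and the symmetry of second derivatives\<close>

text \<open>The definite description in \<open>gradient\<close> needs existence and uniqueness:
  \<open>D\<close> represents the derivative through the inner product, and derivatives are
  unique.\<close>

lemma gradient_works:
  fixes f :: "'a::euclidean_space \<Rightarrow> real"
  assumes "f differentiable (at x)"
  shows "(f has_derivative (\<lambda>h. h \<bullet> gradient f x)) (at x)"
proof -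
  obtain f' where f': "(f has_derivative f') (at x)"
    using assms differentiable_def by blast
  then have "linear f'" by (rule has_derivative_linear)
  define D where "D = (\<Sum>i\<in>Basis. f' i *\<^sub>R i)"
  have "f' h = h \<bullet> D" for h
    using Linear_Algebra.linear_componentwise[OF \<open>linear f'\<close>, of h 1]
    by (simp add: D_def inner_sum_right mult.commute)
  then have "f' = (\<lambda>h. h \<bullet> D)" by blast
  with f' have D: "GDERIV f x :> D" by (simp add: gderiv_def)
  have "GDERIV f x :> gradient f x"
    unfolding gradient_def
  proof (rule theI[of _ D])
    fix D' assume "GDERIV f x :> D'"
    with D have "(\<lambda>h. h \<bullet> D') = (\<lambda>h. h \<bullet> D)"
      unfolding gderiv_def using has_derivative_unique by blast
    then show "D' = D" by (metis vector_eq_ldot)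
  qed (rule D)
  then show ?thesis by (simp add: gderiv_def)
qed

text \<open>This is Schwarz's theorem. The second difference of \<open>f\<close> over the
  parallelogram with sides \<open>s *\<^sub>R u\<close> and \<open>s *\<^sub>R v\<close> is
  symmetric in \<open>u\<close> and \<open>v\<close>; two uses of the mean value theorem equate it
  with \<open>s * s\<close> times a second derivative at a nearby point, and \<open>s\<close> is
  taken small.\<close>

lemma gradient_derivative_symmetric:
  fixes f :: "'a::euclidean_space \<Rightarrow> real"
  assumes f: "\<And>x. (f has_derivative (\<lambda>h. h \<bullet> g x)) (at x)"
    and g: "\<And>x. (g has_derivative blinfun_apply (g' x)) (at x)"
    and cont: "continuous_on UNIV g'"
  shows "g' x u \<bullet> v = u \<bullet> g' x v"
proof -
  have mixed: "\<exists>\<sigma> \<tau>. 0 < \<sigma> \<and> \<sigma> < s \<and> 0 < \<tau> \<and> \<tau> < s \<and>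
      f (x + s *\<^sub>R u + s *\<^sub>R v) - f (x + s *\<^sub>R u) - f (x + s *\<^sub>R v) + f x
      = s * (s * (u \<bullet> g' (x + \<sigma> *\<^sub>R u + \<tau> *\<^sub>R v) v))" if "s > 0" for s u v
  proof -
    \<comment> \<open>The mean value theorem is applied in direction \<open>u\<close> to the
      increment of \<open>f\<close> along \<open>v\<close>, and then in direction \<open>v\<close>
      to the resulting increment of \<open>q\<close>.\<close>
    define p where "p \<sigma> = f (x + \<sigma> *\<^sub>R u + s *\<^sub>R v) - f (x + \<sigma> *\<^sub>R u)" for \<sigma>
    have "(p has_derivative (\<lambda>h. h * (u \<bullet> g (x + \<sigma> *\<^sub>R u + s *\<^sub>R v) - u \<bullet> g (x + \<sigma> *\<^sub>R u))))
       (at \<sigma> within {0..s})" for \<sigma>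
      unfolding p_def
      by (rule derivative_eq_intros has_derivative_compose[OF _ f] refl ext | simp)+
        (simp add: algebra_simps)
    from mvt_simple[OF that this] obtain \<sigma> where \<sigma>: "0 < \<sigma>" "\<sigma> < s"
      and p: "p s - p 0 = s * (u \<bullet> g (x + \<sigma> *\<^sub>R u + s *\<^sub>R v) - u \<bullet> g (x + \<sigma> *\<^sub>R u))" by auto
    define q where "q \<tau> = u \<bullet> g (x + \<sigma> *\<^sub>R u + \<tau> *\<^sub>R v)" for \<tau>
    have "(q has_derivative (\<lambda>h. h * (u \<bullet> g' (x + \<sigma> *\<^sub>R u + \<tau> *\<^sub>R v) v))) (at \<tau> within {0..s})" for \<tau>
      unfolding q_def
      by (rule derivative_eq_intros has_derivative_compose[OF _ g] refl ext | simp)+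
        (simp add: blinfun.scaleR_right)
    from mvt_simple[OF that this] obtain \<tau> where \<tau>: "0 < \<tau>" "\<tau> < s"
      and q: "q s - q 0 = s * (u \<bullet> g' (x + \<sigma> *\<^sub>R u + \<tau> *\<^sub>R v) v)" by auto
    show ?thesis
      using \<sigma> \<tau> p q by (intro exI[of _ \<sigma>] exI[of _ \<tau>]) (auto simp: p_def q_def)
  qed
  have lim: "\<exists>s0>0. \<forall>s \<sigma> \<tau>. 0 < s \<and> s < s0 \<and> 0 < \<sigma> \<and> \<sigma> < s \<and> 0 < \<tau> \<and> \<tau> < s \<longrightarrow>
      \<bar>u \<bullet> g' (x + \<sigma> *\<^sub>R u + \<tau> *\<^sub>R v) v - u \<bullet> g' x v\<bar> < e" if "e > 0" for e u v
  proof -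
    have "continuous_on UNIV (\<lambda>y. u \<bullet> g' y v)"
      by (intro continuous_intros cont)
    then have "isCont (\<lambda>y. u \<bullet> g' y v) x"
      by (simp add: continuous_on_eq_continuous_at)
    then obtain d where d: "d > 0" "\<And>y. dist y x < d \<Longrightarrow> dist (u \<bullet> g' y v) (u \<bullet> g' x v) < e"
      using \<open>e > 0\<close> unfolding continuous_at_eps_delta by blast
    show ?thesis
    proof (intro exI[of _ "d / (norm u + norm v + 1)"] conjI allI impI)
      show "d / (norm u + norm v + 1) > 0" using d(1) by (intro divide_pos_pos) (auto intro: add_nonneg_pos)
      fix s \<sigma> \<tau> :: real
      assume *: "0 < s \<and> s < d / (norm u + norm v + 1) \<and> 0 < \<sigma> \<and> \<sigma> < s \<and> 0 < \<tau> \<and> \<tau> < s"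
      have pos: "norm u + norm v + 1 > 0" by (auto intro: add_nonneg_pos)
      have "norm (\<sigma> *\<^sub>R u + \<tau> *\<^sub>R v) \<le> \<sigma> * norm u + \<tau> * norm v"
        using norm_triangle_ineq[of "\<sigma> *\<^sub>R u" "\<tau> *\<^sub>R v"] * by simp
      also have "\<dots> \<le> s * norm u + s * norm v"
        using * by (intro add_mono mult_right_mono) auto
      also have "\<dots> \<le> s * (norm u + norm v + 1)" using * by (simp add: algebra_simps)
      also have "\<dots> < d" using * pos by (simp add: pos_less_divide_eq)
      finally show "\<bar>u \<bullet> g' (x + \<sigma> *\<^sub>R u + \<tau> *\<^sub>R v) v - u \<bullet> g' x v\<bar> < e"
        using d(2)[of "x + \<sigma> *\<^sub>R u + \<tau> *\<^sub>R v"] by (simp add: dist_norm add.assoc)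
    qed
  qed
  have "\<bar>u \<bullet> g' x v - v \<bullet> g' x u\<bar> \<le> 0 + e" if e: "e > 0" for e
  proof -
    obtain s1 where s1: "s1 > 0" "\<And>s \<sigma> \<tau>. 0 < s \<and> s < s1 \<and> 0 < \<sigma> \<and> \<sigma> < s \<and> 0 < \<tau> \<and> \<tau> < s \<Longrightarrow>
      \<bar>u \<bullet> g' (x + \<sigma> *\<^sub>R u + \<tau> *\<^sub>R v) v - u \<bullet> g' x v\<bar> < e / 2"
      using lim[of "e / 2" u v] half_gt_zero[OF e] by blast
    obtain s2 where s2: "s2 > 0" "\<And>s \<sigma> \<tau>. 0 < s \<and> s < s2 \<and> 0 < \<sigma> \<and> \<sigma> < s \<and> 0 < \<tau> \<and> \<tau> < s \<Longrightarrow>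
      \<bar>v \<bullet> g' (x + \<sigma> *\<^sub>R v + \<tau> *\<^sub>R u) u - v \<bullet> g' x u\<bar> < e / 2"
      using lim[of "e / 2" v u] half_gt_zero[OF e] by blast
    define s where "s = min s1 s2 / 2"
    have s: "s > 0" "s < s1" "s < s2" using s1(1) s2(1) by (auto simp: s_def)
    obtain \<sigma> \<tau> where 1: "0 < \<sigma>" "\<sigma> < s" "0 < \<tau>" "\<tau> < s"
      "f (x + s *\<^sub>R u + s *\<^sub>R v) - f (x + s *\<^sub>R u) - f (x + s *\<^sub>R v) + f x
       = s * (s * (u \<bullet> g' (x + \<sigma> *\<^sub>R u + \<tau> *\<^sub>R v) v))"
      using mixed[OF s(1), of u v] by blast
    obtain \<sigma>' \<tau>' where 2: "0 < \<sigma>'" "\<sigma>' < s" "0 < \<tau>'" "\<tau>' < s"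
      "f (x + s *\<^sub>R v + s *\<^sub>R u) - f (x + s *\<^sub>R v) - f (x + s *\<^sub>R u) + f x
       = s * (s * (v \<bullet> g' (x + \<sigma>' *\<^sub>R v + \<tau>' *\<^sub>R u) u))"
      using mixed[OF s(1), of v u] by blast
    have "f (x + s *\<^sub>R v + s *\<^sub>R u) = f (x + s *\<^sub>R u + s *\<^sub>R v)" by (simp add: add_ac)
    then have "s * (s * (u \<bullet> g' (x + \<sigma> *\<^sub>R u + \<tau> *\<^sub>R v) v)) =
        s * (s * (v \<bullet> g' (x + \<sigma>' *\<^sub>R v + \<tau>' *\<^sub>R u) u))"
      using 1(5) 2(5) by linarith
    then have "u \<bullet> g' (x + \<sigma> *\<^sub>R u + \<tau> *\<^sub>R v) v = v \<bullet> g' (x + \<sigma>' *\<^sub>R v + \<tau>' *\<^sub>R u) u"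
      using s by simp
    then show ?thesis
      using s1(2)[of s \<sigma> \<tau>] s2(2)[of s \<sigma>' \<tau>'] 1 2 s by linarith
  qed
  then have "\<bar>u \<bullet> g' x v - v \<bullet> g' x u\<bar> \<le> 0" by (rule field_le_epsilon)
  then show ?thesis by (simp add: inner_commute)
qed

text \<open>\<open>Min\<close> is sure to pick an element only from a finite nonempty set; symmetry
  of \<open>M\<close> supplies both properties.\<close>

lemma lambda_min_in_eigenvalues:
  fixes M :: "real^'n^'n"
  assumes sym: "\<And>x y. (M *v x) \<bullet> y = x \<bullet> (M *v y)"
  shows "lambda_min M \<in> eigenvalues M"
  unfolding lambda_min_def
proof (rule Min_in)
  show "finite (eigenvalues M)"
    unfolding eigenvalues_def using symmetric_finite_eigenvalues[of "(*v) M"] sym by blast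
  show "eigenvalues M \<noteq> {}"
    unfolding eigenvalues_def using symmetric_has_eigenvector[of "(*v) M"] sym by auto
qed

section \<open>Growth of a quadratic form along perturbed linear orbits\<close>

text \<open>
  The function \<open>K w = \<langle>(A - \<gamma>) w, w\<rangle>\<close> defines the cone. The identity
  \<open>K (A w) - \<gamma>\<^sup>2 K w = \<langle>(A - \<gamma>) w, (A + \<gamma>) (A - \<gamma>) w\<rangle>\<close>
  gives the growth of \<open>K\<close> with a margin proportional to \<open>\<parallel>w\<parallel>\<^sup>2\<close>, which absorbs the perturbation.
\<close>

lemma symmetric_cone_expansion:
  fixes A :: "'a::euclidean_space \<Rightarrow> 'a"
  assumes A: "linear A" and sym: "\<And>x y. A x \<bullet> y = x \<bullet> A y" and psd: "\<And>x. 0 \<le> A x \<bullet> x"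
    and v: "v \<noteq> 0" "A v = a *\<^sub>R v" and "a > 1"
  obtains \<epsilon> where "\<epsilon> > 0"
    "\<And>w t. \<lbrakk>w 0 = t *\<^sub>R v; t \<noteq> 0; \<And>k::nat. norm (w (Suc k) - A (w k)) \<le> \<epsilon> * norm (w k)\<rbrakk>
       \<Longrightarrow> \<not> bounded (range w)"
\<comment> \<open>Only finitely many numbers are eigenvalues, so some \<open>\<gamma>\<close>
  between 1 and \<open>a\<close> is none. Then \<open>A - \<gamma>\<close> is injective, hence
  bounded below, which yields the margin \<open>\<delta>\<close>.\<close>
proof -
  have "infinite ({1<..<a} - {r. \<exists>v. v \<noteq> 0 \<and> A v = r *\<^sub>R v})"
    using symmetric_finite_eigenvalues[of A, OF sym] \<open>a > 1\<close>
    by (simp add: Diff_infinite_finite)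
  then obtain \<gamma> where "\<gamma> \<in> {1<..<a} - {r. \<exists>v. v \<noteq> 0 \<and> A v = r *\<^sub>R v}"
    by (metis all_not_in_conv finite.emptyI)
  then have \<gamma>: "1 < \<gamma>" "\<gamma> < a" "\<And>v. A v = \<gamma> *\<^sub>R v \<Longrightarrow> v = 0"
    by auto
  define B where "B x = A x - \<gamma> *\<^sub>R x" for x
  have B: "linear B"
    unfolding B_def
    using A by (intro linear_compose_sub linear_compose_scale_right linear_id[unfolded id_def])
  have symB: "B x \<bullet> y = x \<bullet> B y" for x y by (simp add: B_def inner_diff sym)
  have BA: "B (A x) = A (B x)" for x
    by (simp add: B_def linear_diff[OF A] linear_cmul[OF A])
  have "inj B"
    using \<gamma>(3) by (subst linear_injective_0[OF B]) (auto simp: B_def)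
  then obtain \<delta> where \<delta>: "\<delta> > 0" "\<And>x. \<delta> * norm x \<le> norm (B x)"
    using linear_inj_bounded_below_pos[OF B] by metis
  obtain M where M: "M > 0" "\<And>x. norm (B x) \<le> M * norm x"
    using linear_bounded_pos[OF B] by blast
  obtain N where N: "N > 0" "\<And>x. norm (A x) \<le> N * norm x"
    using linear_bounded_pos[OF A] by blast
  define K where "K x = B x \<bullet> x" for x
  \<comment> \<open>A perturbation of relative size \<open>\<epsilon>\<close> changes
    \<open>K\<close> by at most \<open>\<epsilon> * (2 * M * N + M)\<close> times the square of
    \<open>norm w\<close>; the cap 1 bounds the quadratic term linearly in
    \<open>\<epsilon>\<close>. The second bound keeps this change within the margin in
    \<open>growA\<close>.\<close>
  define \<epsilon> where "\<epsilon> = min 1 (\<gamma> * \<delta>\<^sup>2 / (2 * M * N + M))"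
  have MN: "2 * M * N + M > 0" using M N by (intro add_pos_pos) auto
  have \<epsilon>: "\<epsilon> > 0" "\<epsilon> \<le> 1" "\<epsilon> * (2 * M * N + M) \<le> \<gamma> * \<delta>\<^sup>2"
    using \<gamma> \<delta> MN by (auto simp: \<epsilon>_def pos_le_divide_eq[symmetric])
  have growA: "K (A w) \<ge> \<gamma>\<^sup>2 * K w + \<gamma> * \<delta>\<^sup>2 * (norm w)\<^sup>2" for w
  proof -
    have "K (A w) = B w \<bullet> A (A w)" by (simp add: K_def BA sym)
    also have "A (A w) = A (B w) + \<gamma> *\<^sub>R B w + \<gamma>\<^sup>2 *\<^sub>R w"
      by (simp add: B_def linear_diff[OF A] linear_cmul[OF A] algebra_simps power2_eq_square)
    also have "B w \<bullet> \<dots> = A (B w) \<bullet> B w + \<gamma> * (norm (B w))\<^sup>2 + \<gamma>\<^sup>2 * K w"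
      by (simp add: inner_add_right K_def power2_norm_eq_inner sym)
    finally have "K (A w) \<ge> \<gamma> * (norm (B w))\<^sup>2 + \<gamma>\<^sup>2 * K w"
      using psd[of "B w"] by simp
    moreover have "(\<delta> * norm w)\<^sup>2 \<le> (norm (B w))\<^sup>2"
      using \<delta> by (intro power_mono) auto
    then have "\<gamma> * (\<delta> * norm w)\<^sup>2 \<le> \<gamma> * (norm (B w))\<^sup>2"
      using \<gamma>(1) by (intro mult_left_mono) auto
    ultimately show ?thesis by (simp add: power_mult_distrib)
  qed
  have grow: "K w' \<ge> \<gamma>\<^sup>2 * K w" if r: "norm (w' - A w) \<le> \<epsilon> * norm w" for w w'
  proof -
    define r where "r = w' - A w"
    have r: "norm r \<le> \<epsilon> * norm w" using that by (simp add: r_def)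
    have "w' = A w + r" by (simp add: r_def)
    then have "K w' = K (A w) + 2 * (B (A w) \<bullet> r) + B r \<bullet> r"
      using symB[of r "A w"]
      by (simp add: K_def linear_add[OF B] inner_add inner_commute)
    moreover have "\<bar>B (A w) \<bullet> r\<bar> \<le> M * N * \<epsilon> * (norm w)\<^sup>2"
    proof -
      have "\<bar>B (A w) \<bullet> r\<bar> \<le> norm (B (A w)) * norm r" by (rule Cauchy_Schwarz_ineq2)
      also have "\<dots> \<le> (M * (N * norm w)) * (\<epsilon> * norm w)"
        using M(2)[of "A w"] N(2)[of w] M(1) N(1) r \<epsilon>(1)
        by (intro mult_mono order.trans[OF M(2)] mult_left_mono) auto
      finally show ?thesis by (simp add: power2_eq_square mult_ac)
    qed
    moreover have "\<bar>B r \<bullet> r\<bar> \<le> M * \<epsilon> * (norm w)\<^sup>2"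
    proof -
      have "\<bar>B r \<bullet> r\<bar> \<le> norm (B r) * norm r" by (rule Cauchy_Schwarz_ineq2)
      also have "\<dots> \<le> (M * norm r) * norm r"
        by (intro mult_right_mono M) auto
      also have "\<dots> \<le> (M * (\<epsilon> * norm w)) * (1 * norm w)"
        using M(1) r \<epsilon> mult_right_mono[OF \<epsilon>(2), of "norm w"]
        by (intro mult_mono mult_left_mono) auto
      finally show ?thesis by (simp add: power2_eq_square mult_ac)
    qed
    moreover have "\<epsilon> * (2 * M * N + M) * (norm w)\<^sup>2 \<le> \<gamma> * \<delta>\<^sup>2 * (norm w)\<^sup>2"
      by (intro mult_right_mono \<epsilon>) auto
    ultimately show ?thesis
      using growA[of w] by (simp add: algebra_simps abs_le_iff)
  qed
  show ?thesis
  proof (rule that[OF \<epsilon>(1)])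
    fix w :: "nat \<Rightarrow> 'a" and t
    assume w0: "w 0 = t *\<^sub>R v" and "t \<noteq> 0"
      and w: "\<And>k. norm (w (Suc k) - A (w k)) \<le> \<epsilon> * norm (w k)"
    have "K (w 0) = t\<^sup>2 * (a - \<gamma>) * (v \<bullet> v)"
      by (simp add: K_def B_def w0 linear_cmul[OF A] v(2) algebra_simps power2_eq_square)
    then have K0: "K (w 0) > 0" using \<open>t \<noteq> 0\<close> \<gamma>(2) v(1) by simp
    \<comment> \<open>Geometric growth from a positive start contradicts the bound
      \<open>M * R\<^sup>2\<close> that \<open>K\<close> obeys on a bounded orbit.\<close>
    have Kn: "K (w n) \<ge> (\<gamma>\<^sup>2) ^ n * K (w 0)" for n
    proof (induction n)
      case (Suc n)
      have "\<gamma>\<^sup>2 * ((\<gamma>\<^sup>2) ^ n * K (w 0)) \<le> \<gamma>\<^sup>2 * K (w n)"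
        using Suc by (intro mult_left_mono) auto
      then show ?case using grow[OF w[of n]] by (simp add: mult.assoc)
    qed simp
    show "\<not> bounded (range w)"
    proof
      assume "bounded (range w)"
      then obtain R where R: "\<And>n. norm (w n) \<le> R" by (auto simp: bounded_iff)
      have "(\<gamma>\<^sup>2) ^ n \<le> M * R\<^sup>2 / K (w 0)" for n
      proof -
        have "(\<gamma>\<^sup>2) ^ n * K (w 0) \<le> K (w n)" by (rule Kn)
        also have "\<dots> \<le> norm (B (w n)) * norm (w n)"
          unfolding K_def by (rule norm_cauchy_schwarz)
        also have "\<dots> \<le> M * norm (w n) * norm (w n)"
          by (intro mult_right_mono M) auto
        also have "\<dots> = M * (norm (w n))\<^sup>2" by (simp add: power2_eq_square)
        also have "\<dots> \<le> M * R\<^sup>2"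
          using M(1) R[of n] by (intro mult_left_mono power_mono) auto
        finally show ?thesis using K0 by (simp add: pos_le_divide_eq)
      qed
      moreover have "\<gamma>\<^sup>2 > 1" using \<gamma>(1) by (simp add: one_less_power)
      ultimately show False
        using real_arch_pow[of "\<gamma>\<^sup>2"] by (metis not_le)
    qed
  qed
qed

section \<open>Orbits of time-dependent maps\<close>

primrec orbit :: "(nat \<Rightarrow> 'a \<Rightarrow> 'a) \<Rightarrow> nat \<Rightarrow> 'a \<Rightarrow> 'a" where
  "orbit T 0 x = x"
| "orbit T (Suc k) x = T k (orbit T k x)"

text \<open>Restarting the clock at time \<open>N\<close> turns a property that holds only from
  \<open>N\<close> on into one that holds from time 0 for the shifted family.\<close>

lemma orbit_shift: "orbit T (N + k) x = orbit (\<lambda>k. T (N + k)) k (orbit T N x)"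
  by (induction k) auto

lemma continuous_on_orbit:
  assumes "\<And>k. continuous_on UNIV (T k)"
  shows "continuous_on UNIV (orbit T k)"
proof (induction k)
  case (Suc k)
  then show ?case
    using continuous_on_compose2[OF assms[of k]] by fastforce
qed (simp add: continuous_on_id)

lemma orbit_expansive:
  assumes "c \<ge> 0" and T: "\<And>k x y. c * dist x y \<le> dist (T k x) (T k y)"
  shows "c ^ k * dist x y \<le> dist (orbit T k x) (orbit T k y)"
proof (induction k)
  case (Suc k)
  have "c * (c ^ k * dist x y) \<le> c * dist (orbit T k x) (orbit T k y)"
    using Suc \<open>c \<ge> 0\<close> by (rule mult_left_mono)
  also have "\<dots> \<le> dist (orbit T (Suc k) x) (orbit T (Suc k) y)"
    using T by simp
  finally show ?case by (simp add: mult.assoc)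
qed simp

text \<open>Two orbits that stay in the ball have a bounded difference, which by \<open>T\<close> is
  a perturbed orbit of \<open>A\<close>. If their starting points differed by a nonzero multiple of
  \<open>v\<close>, then \<open>exp\<close> would make it unbounded. So the trapped set, which is
  compact, meets each line in direction \<open>v\<close> at most once.\<close>

lemma negligible_trapped_orbits:
  fixes T :: "nat \<Rightarrow> 'a::euclidean_space \<Rightarrow> 'a"
  assumes v: "v \<noteq> 0" and cont: "\<And>k. continuous_on UNIV (T k)"
    and exp: "\<And>w t. \<lbrakk>w 0 = t *\<^sub>R v; t \<noteq> 0;
          \<And>k::nat. norm (w (Suc k) - A (w k)) \<le> \<epsilon> * norm (w k)\<rbrakk> \<Longrightarrow> \<not> bounded (range w)"
    and T: "\<And>k x y. \<lbrakk>x \<in> cball p \<delta>; y \<in> cball p \<delta>\<rbrakk>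
          \<Longrightarrow> norm (T k x - T k y - A (x - y)) \<le> \<epsilon> * norm (x - y)"
  shows "negligible {x. \<forall>k. orbit T k x \<in> cball p \<delta>}" (is "negligible ?S")
proof (rule negligible_disjoint_translates[OF _ v])
  have S: "?S = (\<Inter>k. orbit T k -` cball p \<delta>)" by auto
  have "closed ?S" unfolding S
    by (intro closed_INT ballI continuous_closed_vimage)
      (use continuous_on_orbit[OF cont] in \<open>auto simp: continuous_on_eq_continuous_at\<close>)
  \<comment> \<open>The instance \<open>k = 0\<close> puts the starting point itself in the
    ball.\<close>
  moreover have "?S \<subseteq> cball p \<delta>" using orbit.simps(1)[of T] by (metis (mono_tags) mem_Collect_eq subsetI)
  ultimately show "compact ?S" by (metis bounded_cball bounded_subset compact_eq_bounded_closed)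
next
  fix x t assume xy: "x \<in> ?S" "x + t *\<^sub>R v \<in> ?S"
  define w where "w k = orbit T k (x + t *\<^sub>R v) - orbit T k x" for k
  have "bounded (range w)"
  proof (rule boundedI)
    fix z assume "z \<in> range w"
    then obtain k where "z = w k" by auto
    moreover have "dist p (orbit T k (x + t *\<^sub>R v)) \<le> \<delta>" "dist p (orbit T k x) \<le> \<delta>"
      using xy by auto
    ultimately show "norm z \<le> 2 * \<delta>"
      using dist_triangle3[of "orbit T k (x + t *\<^sub>R v)" "orbit T k x" p]
      by (simp add: w_def dist_norm)
  qed
  moreover have "w 0 = t *\<^sub>R v" by (simp add: w_def)
  moreover have "norm (w (Suc k) - A (w k)) \<le> \<epsilon> * norm (w k)" for k
    using T[of "orbit T k (x + t *\<^sub>R v)" "orbit T k x" k] xy by (simp add: w_def)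
  ultimately show "t = 0" using exp by blast
qed

text \<open>The lower bound, in which \<open>c\<close> may be below 1, makes \<open>F\<close>
  injective with a Lipschitz inverse on its image, and Lipschitz maps preserve null sets.\<close>

lemma negligible_expansive_preimage:
  fixes F :: "'a::euclidean_space \<Rightarrow> 'a"
  assumes N: "negligible N" and "c > 0" and F: "\<And>x y. c * dist x y \<le> dist (F x) (F y)"
    and S: "F ` S \<subseteq> N"
  shows "negligible S"
proof -
  have "inj F" using F \<open>c > 0\<close>
    by (metis dist_eq_0_iff dist_self injI mult_le_0_iff not_le zero_le_dist order_antisym)
  have "negligible (inv F ` (F ` S))"
  proof (rule negligible_locally_Lipschitz_image[OF order_refl])
    show "negligible (F ` S)" using N S negligible_subset by blast
    fix x assume "x \<in> F ` S"
    then obtain s where s: "x = F s" by blast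
    have "norm (inv F y - inv F x) \<le> (1 / c) * norm (y - x)" if y: "y \<in> F ` S" for y
    proof -
      obtain u where "y = F u" using y by blast
      then show ?thesis
        using F[of u s] \<open>c > 0\<close> \<open>inj F\<close> s by (simp add: dist_norm field_simps)
    qed
    then show "\<exists>T B. open T \<and> x \<in> T \<and>
        (\<forall>y\<in>F ` S \<inter> T. norm (inv F y - inv F x) \<le> B * norm (y - x))"
      by (intro exI[of _ UNIV] exI[of _ "1 / c"]) auto
  qed
  then show ?thesis using \<open>inj F\<close> by (simp add: image_comp)
qed

section \<open>Convergence to a set of unstable points\<close>

text \<open>Around each \<open>p\<close> in \<open>X\<close> some ball traps only a null set of
  orbits, whatever the entrance time. A convergent orbit eventually stays in any open ball around
  its limit, so a countable cover of \<open>X\<close> by such balls gives a countable union of null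
  sets.\<close>

theorem negligible_converging_to_unstable:
  fixes T :: "nat \<Rightarrow> 'a::euclidean_space \<Rightarrow> 'a"
  assumes cont: "\<And>k. continuous_on UNIV (T k)"
    and "c > 0" and expansive: "\<And>k x y. c * dist x y \<le> dist (T k x) (T k y)"
    and unstable: "\<And>p. p \<in> X \<Longrightarrow> \<exists>A v a. linear A \<and> (\<forall>x y. A x \<bullet> y = x \<bullet> A y) \<and> (\<forall>x. 0 \<le> A x \<bullet> x) \<and>
        v \<noteq> 0 \<and> A v = a *\<^sub>R v \<and> a > 1 \<and>
        (\<forall>\<epsilon>>0. \<exists>\<delta>>0. \<forall>\<^sub>F k in sequentially. \<forall>x\<in>cball p \<delta>. \<forall>y\<in>cball p \<delta>.
           norm (T k x - T k y - A (x - y)) \<le> \<epsilon> * norm (x - y))"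
  shows "negligible {x. \<exists>p\<in>X. (\<lambda>k. orbit T k x) \<longlonglongrightarrow> p}"
proof -
  have trap: "\<exists>\<delta>>0. \<forall>N. negligible {x. \<forall>k\<ge>N. orbit T k x \<in> cball p \<delta>}" if p: "p \<in> X" for p
  proof -
    obtain A v a where A: "linear A" "\<And>x y. A x \<bullet> y = x \<bullet> A y" "\<And>x. 0 \<le> A x \<bullet> x"
        "v \<noteq> 0" "A v = a *\<^sub>R v" "a > 1"
      and loc: "\<And>\<epsilon>. \<epsilon> > 0 \<Longrightarrow> \<exists>\<delta>>0. \<forall>\<^sub>F k in sequentially. \<forall>x\<in>cball p \<delta>. \<forall>y\<in>cball p \<delta>.
           norm (T k x - T k y - A (x - y)) \<le> \<epsilon> * norm (x - y)"
      using unstable[OF p] by blast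
    obtain \<epsilon> where "\<epsilon> > 0" and exp:
      "\<And>w t. \<lbrakk>w 0 = t *\<^sub>R v; t \<noteq> 0; \<And>k::nat. norm (w (Suc k) - A (w k)) \<le> \<epsilon> * norm (w k)\<rbrakk>
       \<Longrightarrow> \<not> bounded (range w)"
      using symmetric_cone_expansion[OF A] by blast
    obtain \<delta> M where "\<delta> > 0" and M: "\<And>k x y. \<lbrakk>k \<ge> M; x \<in> cball p \<delta>; y \<in> cball p \<delta>\<rbrakk> \<Longrightarrow>
           norm (T k x - T k y - A (x - y)) \<le> \<epsilon> * norm (x - y)"
      using loc[OF \<open>\<epsilon> > 0\<close>] unfolding eventually_sequentially by blast
    have "negligible {x. \<forall>k\<ge>N. orbit T k x \<in> cball p \<delta>}" for N
    proof (rule negligible_expansive_preimage)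
      \<comment> \<open>From \<open>N'\<close> on the orbit is in the ball and the linear
        approximation holds, so the null trapped set of the shifted family is pulled back through
        the first \<open>N'\<close> maps.\<close>
      define N' where "N' = max N M"
      show "negligible {x. \<forall>k. orbit (\<lambda>k. T (N' + k)) k x \<in> cball p \<delta>}"
        by (rule negligible_trapped_orbits[OF A(4) _ exp])
          (auto intro!: cont M[unfolded mem_cball] simp: N'_def)
      show "c ^ N' * dist x y \<le> dist (orbit T N' x) (orbit T N' y)" for x y
        using orbit_expansive[OF _ expansive] \<open>c > 0\<close> by simp
      show "orbit T N' ` {x. \<forall>k\<ge>N. orbit T k x \<in> cball p \<delta>}
          \<subseteq> {x. \<forall>k. orbit (\<lambda>k. T (N' + k)) k x \<in> cball p \<delta>}"
        by (auto simp: orbit_shift[symmetric] N'_def)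
    qed (use \<open>c > 0\<close> in simp)
    then show ?thesis using \<open>\<delta> > 0\<close> by blast
  qed
  define P where "P p \<delta> \<longleftrightarrow> \<delta> > 0 \<and> (\<forall>N. negligible {x. \<forall>k\<ge>N. orbit T k x \<in> cball p \<delta>})"
    for p \<delta>
  have "\<forall>p\<in>X. \<exists>\<delta>. P p \<delta>" using trap unfolding P_def by blast
  from bchoice[OF this] obtain \<delta> where "\<forall>p\<in>X. P p (\<delta> p)" ..
  then have \<delta>: "\<delta> p > 0" "negligible {x. \<forall>k\<ge>N. orbit T k x \<in> cball p (\<delta> p)}" if "p \<in> X" for p N
    using that unfolding P_def by blast+
  \<comment> \<open>Open balls serve for the countable cover, closed balls for the compactness of
    trapped sets.\<close>
  have "open S" if "S \<in> (\<lambda>p. ball p (\<delta> p)) ` X" for S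
    using that by auto
  then obtain \<F> where \<F>: "\<F> \<subseteq> (\<lambda>p. ball p (\<delta> p)) ` X" "countable \<F>"
      "\<Union>\<F> = (\<Union>p\<in>X. ball p (\<delta> p))"
    by (rule Lindelof)
  obtain Y where Y: "Y \<subseteq> X" "countable Y" "\<F> = (\<lambda>p. ball p (\<delta> p)) ` Y"
    using countable_subset_image[of \<F> "\<lambda>p. ball p (\<delta> p)" X] \<F>(1,2) by blast
  have "negligible (\<Union>p\<in>Y. \<Union>N. {x. \<forall>k\<ge>N. orbit T k x \<in> cball p (\<delta> p)})"
  proof (rule negligible_countable_Union[OF countable_image[OF Y(2)]])
    fix S assume "S \<in> (\<lambda>p. \<Union>N. {x. \<forall>k\<ge>N. orbit T k x \<in> cball p (\<delta> p)}) ` Y"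
    then obtain p where p: "p \<in> Y" "S = (\<Union>N. {x. \<forall>k\<ge>N. orbit T k x \<in> cball p (\<delta> p)})"
      by blast
    then show "negligible S"
      unfolding p(2) using p(1) Y(1) by (intro negligible_Union_nat \<delta>(2)) blast
  qed
  moreover have "{x. \<exists>p\<in>X. (\<lambda>k. orbit T k x) \<longlonglongrightarrow> p}
      \<subseteq> (\<Union>p\<in>Y. \<Union>N. {x. \<forall>k\<ge>N. orbit T k x \<in> cball p (\<delta> p)})"
  proof
    fix x assume "x \<in> {x. \<exists>p\<in>X. (\<lambda>k. orbit T k x) \<longlonglongrightarrow> p}"
    then obtain p where "p \<in> X" and lim: "(\<lambda>k. orbit T k x) \<longlonglongrightarrow> p"
      by blast
    then have "p \<in> \<Union>\<F>" unfolding \<F>(3) by (intro UN_I[of p]) (auto simp: \<delta>(1))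
    \<comment> \<open>The ball containing the limit \<open>p\<close> may be centred at a different
      point \<open>q\<close>; being trapped in it is all that is used.\<close>
    then obtain q where q: "q \<in> Y" "p \<in> ball q (\<delta> q)" using Y(3) by auto
    then have "\<forall>\<^sub>F k in sequentially. orbit T k x \<in> ball q (\<delta> q)"
      using lim topological_tendstoD open_ball by blast
    then obtain N where "\<forall>k\<ge>N. orbit T k x \<in> ball q (\<delta> q)"
      unfolding eventually_sequentially by blast
    then show "x \<in> (\<Union>p\<in>Y. \<Union>N. {x. \<forall>k\<ge>N. orbit T k x \<in> cball p (\<delta> p)})"
      using q(1) by (auto intro!: bexI[of _ q] exI[of _ N] simp: less_imp_le)
  qed
  ultimately show ?thesis using negligible_subset by blast
qed

section \<open>Linearization of the update and the Hessian\<close>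

text \<open>The mean value inequality is applied in the first variable to the remainder
  \<open>r\<close>. Its derivative is small by continuity of \<open>q'\<close> at the base point in
  both variables jointly, so one radius serves all nearby \<open>h\<close>.\<close>

lemma C1_partial_linearization:
  fixes q :: "'a::real_normed_vector \<times> 'b::real_normed_vector \<Rightarrow> 'c::real_normed_vector"
  assumes q: "\<And>z. (q has_derivative blinfun_apply (q' z)) (at z)"
    and cont: "continuous_on UNIV q'" and "\<epsilon> > 0"
  shows "\<exists>\<delta>>0. \<forall>h\<in>cball h\<^sub>0 \<delta>. \<forall>x\<in>cball p \<delta>. \<forall>y\<in>cball p \<delta>.
      norm (q (x, h) - q (y, h) - q' (p, h\<^sub>0) (x - y, 0)) \<le> \<epsilon> * norm (x - y)"
proof -
  have "isCont q' (p, h\<^sub>0)" using cont by (simp add: continuous_on_eq_continuous_at)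
  then obtain d where d: "d > 0" "\<And>z. dist z (p, h\<^sub>0) < d \<Longrightarrow> dist (q' z) (q' (p, h\<^sub>0)) < \<epsilon>"
    using \<open>\<epsilon> > 0\<close> unfolding continuous_at_eps_delta by blast
  \<comment> \<open>The distance in the product is at most the sum of the two component distances,
    so radius \<open>d / 3\<close> in each keeps it below \<open>d\<close>.\<close>
  have "norm (q (x, h) - q (y, h) - q' (p, h\<^sub>0) (x - y, 0)) \<le> \<epsilon> * norm (x - y)"
    if h: "h \<in> cball h\<^sub>0 (d / 3)" and xy: "x \<in> cball p (d / 3)" "y \<in> cball p (d / 3)" for h x y
  proof -
    define r where "r x = q (x, h) - q' (p, h\<^sub>0) (x, 0)" for x
    have "norm (r x - r y) \<le> \<epsilon> * norm (x - y)"
    proof (rule differentiable_bound[OF convex_cball _ _ xy])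
      fix u assume u: "u \<in> cball p (d / 3)"
      show "(r has_derivative (\<lambda>w. q' (u, h) (w, 0) - q' (p, h\<^sub>0) (w, 0))) (at u within cball p (d / 3))"
        unfolding r_def
        by (intro has_derivative_diff has_derivative_compose[OF _ q, of "\<lambda>x. (x, h)"]
            bounded_linear.has_derivative[OF blinfun.bounded_linear_right] has_derivative_Pair
            has_derivative_ident has_derivative_const)
      have "dist (u, h) (p, h\<^sub>0) \<le> dist u p + dist h h\<^sub>0"
        unfolding dist_Pair_Pair by (intro sqrt_sum_squares_le_sum) auto
      also have "\<dots> < d" using u h d(1) by (simp add: dist_commute)
      finally have le: "norm (q' (u, h) - q' (p, h\<^sub>0)) \<le> \<epsilon>"
        using d(2) by (simp add: dist_norm less_imp_le)
      show "onorm (\<lambda>w. q' (u, h) (w, 0) - q' (p, h\<^sub>0) (w, 0)) \<le> \<epsilon>"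
      proof (rule onorm_bound)
        fix w :: 'a
        have "norm ((q' (u, h) - q' (p, h\<^sub>0)) (w, 0)) \<le> norm (q' (u, h) - q' (p, h\<^sub>0)) * norm (w, 0::'b)"
          by (rule norm_blinfun)
        also have "\<dots> \<le> \<epsilon> * norm w"
          using le by (simp add: norm_Pair mult_right_mono)
        finally show "norm (q' (u, h) (w, 0) - q' (p, h\<^sub>0) (w, 0)) \<le> \<epsilon> * norm w"
          by (simp add: blinfun.diff_left)
      qed (use \<open>\<epsilon> > 0\<close> in simp)
    qed
    moreover have "(x - y, 0::'b) = (x, 0) - (y, 0)" by simp
    then have "q' (p, h\<^sub>0) (x - y, 0) = q' (p, h\<^sub>0) (x, 0) - q' (p, h\<^sub>0) (y, 0)"
      by (metis blinfun.diff_right)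
    then have "q (x, h) - q (y, h) - q' (p, h\<^sub>0) (x - y, 0) = r x - r y" by (simp add: r_def)
    ultimately show ?thesis by simp
  qed
  then show ?thesis using d(1) by (intro exI[of _ "d / 3"]) simp
qed

text \<open>By Cauchy-Schwarz the difference quotients of
  \<open>g (p + t *\<^sub>R x) \<bullet> x\<close> in \<open>t\<close> are at most
  \<open>L * (x \<bullet> x)\<close>, and so is their limit \<open>g' x \<bullet> x\<close>.\<close>

lemma lipschitz_derivative_inner_le:
  fixes g :: "'a::real_inner \<Rightarrow> 'a"
  assumes L: "L-lipschitz_on UNIV g" and g: "(g has_derivative g') (at p)"
  shows "g' x \<bullet> x \<le> L * (x \<bullet> x)"
proof -
  have "((\<lambda>t. g (p + t *\<^sub>R x) \<bullet> x) has_derivative (\<lambda>t. g' (t *\<^sub>R x) \<bullet> x)) (at 0)"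
    by (rule derivative_eq_intros has_derivative_compose[of "\<lambda>t. p + t *\<^sub>R x" _ 0 UNIV g g']
        g refl ext | simp)+
  moreover have "(\<lambda>t. g' (t *\<^sub>R x) \<bullet> x) = (*) (g' x \<bullet> x)"
    using linear_cmul[OF has_derivative_linear[OF g]] by (auto simp: mult.commute)
  ultimately have "DERIV (\<lambda>t. g (p + t *\<^sub>R x) \<bullet> x) 0 :> g' x \<bullet> x"
    by (simp add: has_field_derivative_def)
  then have lim: "((\<lambda>t. (g (p + t *\<^sub>R x) \<bullet> x - g p \<bullet> x) / t) \<longlongrightarrow> g' x \<bullet> x) (at 0)"
    by (simp add: DERIV_def)
  have "(g (p + t *\<^sub>R x) \<bullet> x - g p \<bullet> x) / t \<le> L * (x \<bullet> x)" for t
  proof -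
    have "\<bar>g (p + t *\<^sub>R x) \<bullet> x - g p \<bullet> x\<bar> \<le> norm (g (p + t *\<^sub>R x) - g p) * norm x"
      using Cauchy_Schwarz_ineq2[of "g (p + t *\<^sub>R x) - g p" x] by (simp add: inner_diff_left)
    also have "\<dots> \<le> L * norm (t *\<^sub>R x) * norm x"
      using lipschitz_onD[OF L, of "p + t *\<^sub>R x" p] by (intro mult_right_mono) (auto simp: dist_norm)
    also have "\<dots> = \<bar>t\<bar> * (L * (x \<bullet> x))"
      by (simp add: power2_norm_eq_inner[symmetric] power2_eq_square)
    finally have le: "\<bar>g (p + t *\<^sub>R x) \<bullet> x - g p \<bullet> x\<bar> \<le> \<bar>t\<bar> * (L * (x \<bullet> x))" .
    have "(g (p + t *\<^sub>R x) \<bullet> x - g p \<bullet> x) / t \<le> \<bar>g (p + t *\<^sub>R x) \<bullet> x - g p \<bullet> x\<bar> / \<bar>t\<bar>"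
      by (metis abs_divide abs_ge_self)
    also have "\<dots> \<le> L * (x \<bullet> x)"
    proof (cases "t = 0")
      \<comment> \<open>Division by 0 yields 0, so the claim reduces to \<open>L\<close> being
        nonnegative.\<close>
      case True
      then show ?thesis using lipschitz_on_nonneg[OF L] by simp
    next
      case False
      then show ?thesis using le by (simp add: divide_le_eq mult.commute)
    qed
    finally show ?thesis .
  qed
  then show ?thesis
    by (intro tendsto_upperbound[OF lim]) auto
qed

text \<open>The Jacobian matrix of the gradient represents its derivative; by uniqueness it agrees
  with the continuous derivative from \<open>C1\<close>, whose symmetry is Schwarz's
  theorem.\<close>

lemma C2_hessian:
  fixes f :: "real^'n \<Rightarrow> real"
  assumes "C2 f"
  shows hessian_works: "(gradient f has_derivative (*v) (hessian f x)) (at x)"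
    and hessian_symmetric: "(hessian f x *v u) \<bullet> v = u \<bullet> (hessian f x *v v)"
proof -
  obtain g' where g': "\<And>x. (gradient f has_derivative blinfun_apply (g' x)) (at x)"
    "continuous_on UNIV g'"
    using assms unfolding C2_def C1_def by blast
  have "gradient f differentiable (at x)" for x
    using g'(1) differentiable_def by blast
  then show D: "(gradient f has_derivative (*v) (hessian f x)) (at x)" for x
    unfolding hessian_def using jacobian_works by blast
  have "(*v) (hessian f x) = blinfun_apply (g' x)"
    using has_derivative_unique[OF D g'(1)] .
  moreover have "f differentiable (at x)" for x
    using assms unfolding C2_def C1_def differentiable_def by blast
  then have "g' x u \<bullet> v = u \<bullet> g' x v"
    using gradient_derivative_symmetric[OF gradient_works g'] by blast
  ultimately show "(hessian f x *v u) \<bullet> v = u \<bullet> (hessian f x *v v)" by simp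
qed

section \<open>The well-behaved dynamical system\<close>

text \<open>The second component evolves on its own, so it can be fixed as a sequence
  \<open>H\<close>; the first component is then an orbit of time-dependent maps.\<close>

lemma g0_funpow:
  assumes H: "\<And>k. H (Suc k) = \<beta> * q\<^sub>h (H k)"
  shows "(g0 \<eta> \<beta> q\<^sub>x q\<^sub>h ^^ k) (x, H 0) = (orbit (\<lambda>k x. x - \<eta> *\<^sub>R q\<^sub>x (x, H k)) k x, H k)"
proof (induction k)
  case (Suc k)
  have "g0 \<eta> \<beta> q\<^sub>x q\<^sub>h (y, s) = (y - \<eta> *\<^sub>R q\<^sub>x (y, s), \<beta> * q\<^sub>h s)" for y s
    by (simp add: g0_def)
  with Suc show ?case by (simp only: funpow.simps comp_apply orbit.simps H)
qed simp

lemma contraction_funpow_tendsto_zero: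
  fixes \<phi> :: "'a::real_normed_vector \<Rightarrow> 'a"
  assumes "0 \<le> \<theta>" "\<theta> < 1" and \<phi>: "\<And>h. norm (\<phi> h) \<le> \<theta> * norm h"
  shows "(\<lambda>k. (\<phi> ^^ k) h) \<longlonglongrightarrow> 0"
proof (rule Lim_null_comparison)
  have "norm ((\<phi> ^^ k) h) \<le> \<theta> ^ k * norm h" for k
  proof (induction k)
    case (Suc k)
    have "\<theta> * norm ((\<phi> ^^ k) h) \<le> \<theta> * (\<theta> ^ k * norm h)"
      using Suc assms(1) by (rule mult_left_mono)
    then show ?case using \<phi>[of "(\<phi> ^^ k) h"] by (simp add: mult.assoc)
  qed simp
  then show "\<forall>\<^sub>F k in sequentially. norm ((\<phi> ^^ k) h) \<le> \<theta> ^ k * norm h" by simp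
  show "(\<lambda>k. \<theta> ^ k * norm h) \<longlonglongrightarrow> 0"
    using assms by (intro tendsto_mult_left_zero LIMSEQ_realpow_zero)
qed

text \<open>For \<open>L = 0\<close> the bound \<open>1 / L\<close> means infinity, whereas HOL
  division gives 0; hence the implication in the hypothesis on \<open>\<eta>\<close>. Positivity of
  \<open>B\<close> follows from the derivative bounds on \<open>q\<^sub>h\<close>.\<close>

theorem theorem1:
  fixes f :: "real^'n \<Rightarrow> real"
    and q\<^sub>x :: "(real^'n) \<times> real \<Rightarrow> real^'n"
    and q\<^sub>h :: "real \<Rightarrow> real"
    and \<l> L B c \<eta> \<beta> h\<^sub>0 :: real
  assumes "C2 f"
    and "\<l>-lipschitz_on UNIV (gradient f)"
    and "\<eta> > 0" and "\<beta> > 0"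
    and "well_behaved L B c f q\<^sub>x q\<^sub>h"
    and "L > 0 \<longrightarrow> \<eta> < 1 / L"
    and "\<beta> < 1 / B"
  shows "{x\<^sub>0. \<exists>x \<in> strict_saddles f.
            (\<lambda>k. fst ((g0 \<eta> \<beta> q\<^sub>x q\<^sub>h ^^ k) (x\<^sub>0, h\<^sub>0))) \<longlonglongrightarrow> x} \<in> null_sets lebesgue"
proof -
  have "C1 q\<^sub>h" "q\<^sub>h 0 = 0" and L: "\<And>h. L-lipschitz_on UNIV (\<lambda>x. q\<^sub>x (x, h))"
    and qh': "\<And>h. 0 < deriv q\<^sub>h h" "\<And>h. deriv q\<^sub>h h \<le> B"
    and approx: "\<And>x h. norm (q\<^sub>x (x, h) - gradient f x) \<le> c * \<bar>h\<bar>"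
    using assms(5) by (auto simp: well_behaved_def)
  obtain q' where q': "\<And>z. (q\<^sub>x has_derivative blinfun_apply (q' z)) (at z)" "continuous_on UNIV q'"
    using assms(5) unfolding well_behaved_def C1_def by blast
  \<comment> \<open>The closeness bound is 0 at \<open>h = 0\<close>, so the limiting update is
    exact gradient descent.\<close>
  have grad: "q\<^sub>x (x, 0) = gradient f x" for x using approx[of x 0] by simp
  have "L \<ge> 0" using L lipschitz_on_nonneg by blast
  have \<eta>L: "\<eta> * L < 1"
    using assms(6) \<open>L \<ge> 0\<close> by (cases "L = 0") (auto simp: pos_less_divide_eq)
  define H where "H k = ((\<lambda>h. \<beta> * q\<^sub>h h) ^^ k) h\<^sub>0" for k
  define T where "T k x = x - \<eta> *\<^sub>R q\<^sub>x (x, H k)" for k x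
  have "H \<longlonglongrightarrow> 0"
    unfolding H_def
  proof (rule contraction_funpow_tendsto_zero)
    have "B > 0" using qh'[of 0] by linarith
    then show "0 \<le> \<beta> * B" "\<beta> * B < 1"
      using assms(4,7) by (auto simp: pos_less_divide_eq)
    fix h
    have "DERIV q\<^sub>h x :> deriv q\<^sub>h x" for x
    proof -
      have "q\<^sub>h differentiable (at x)"
        using \<open>C1 q\<^sub>h\<close> unfolding C1_def differentiable_def by blast
      then show ?thesis
        by (metis DERIV_deriv_iff_real_differentiable)
    qed
    \<comment> \<open>The mean value inequality between \<open>h\<close> and the fixed point 0 makes
      \<open>\<beta> * q\<^sub>h h\<close> contract towards 0 with factor
      \<open>\<beta> * B\<close>.\<close>
    then have "norm (q\<^sub>h h - q\<^sub>h 0) \<le> B * norm (h - 0)"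
      by (intro field_differentiable_bound[of UNIV q\<^sub>h "deriv q\<^sub>h"])
        (auto simp: abs_of_pos qh')
    then show "norm (\<beta> * q\<^sub>h h) \<le> \<beta> * B * norm h"
      using \<open>q\<^sub>h 0 = 0\<close> assms(4) by (simp add: abs_mult)
  qed
  have "negligible {x. \<exists>p\<in>strict_saddles f. (\<lambda>k. orbit T k x) \<longlonglongrightarrow> p}"
  proof (rule negligible_converging_to_unstable)
    have "continuous_on UNIV q\<^sub>x"
      by (rule has_derivative_continuous_on[OF has_derivative_at_withinI[OF q'(1)]])
    then have "continuous_on UNIV (\<lambda>x. q\<^sub>x (x, H k))" for k
      by (rule continuous_on_compose2) (simp_all add: continuous_on_Pair)
    then show "continuous_on UNIV (T k)" for k
      unfolding T_def
      by (intro continuous_on_diff continuous_on_scaleR continuous_on_id continuous_on_const)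
    show "1 - \<eta> * L > 0" using \<eta>L by simp
    show "(1 - \<eta> * L) * dist x y \<le> dist (T k x) (T k y)" for k x y
    proof -
      have "norm (\<eta> *\<^sub>R (q\<^sub>x (x, H k) - q\<^sub>x (y, H k))) \<le> \<eta> * (L * norm (x - y))"
        using lipschitz_onD[OF L[of "H k"], of x y] assms(3) by (simp add: dist_norm)
      moreover have "T k x - T k y = (x - y) - \<eta> *\<^sub>R (q\<^sub>x (x, H k) - q\<^sub>x (y, H k))"
        by (simp add: T_def algebra_simps)
      then have "norm (x - y) - norm (\<eta> *\<^sub>R (q\<^sub>x (x, H k) - q\<^sub>x (y, H k))) \<le> norm (T k x - T k y)"
        by (simp only: norm_triangle_ineq2)
      ultimately have "norm (x - y) - \<eta> * (L * norm (x - y)) \<le> norm (T k x - T k y)"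
        by linarith
      then show ?thesis by (simp add: dist_norm left_diff_distrib mult.assoc)
    qed
    fix p assume "p \<in> strict_saddles f"
    then have neg: "lambda_min (hessian f p) < 0" by (simp add: strict_saddles_def)
    define r where "r = lambda_min (hessian f p)"
    have "r \<in> eigenvalues (hessian f p)"
      unfolding r_def using hessian_symmetric[OF assms(1)] by (rule lambda_min_in_eigenvalues)
    then obtain v where v: "v \<noteq> 0" "hessian f p *v v = r *\<^sub>R v"
      by (auto simp: eigenvalues_def)
    define A where "A x = x - \<eta> *\<^sub>R (hessian f p *v x)" for x
    \<comment> \<open>Since \<open>q\<^sub>x\<close> restricted to \<open>h = 0\<close> is the
      gradient, its partial derivative there is the Hessian, which identifies the limiting
      linearization at \<open>p\<close>.\<close>
    have partial: "q' (p, 0) (w, 0) = hessian f p *v w" for w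
    proof -
      have "((\<lambda>x. q\<^sub>x (x, 0)) has_derivative (\<lambda>w. q' (p, 0) (w, 0))) (at p)"
        by (intro has_derivative_compose[OF _ q'(1), of "\<lambda>x. (x, 0)"] has_derivative_Pair
            has_derivative_ident has_derivative_const)
      then have "(gradient f has_derivative (\<lambda>w. q' (p, 0) (w, 0))) (at p)"
        by (simp add: grad)
      then have "(\<lambda>w. q' (p, 0) (w, 0)) = (*v) (hessian f p)"
        using hessian_works[OF assms(1)] by (rule has_derivative_unique)
      then show ?thesis by (rule fun_cong)
    qed
    have "linear A"
      unfolding A_def
      by (intro linear_compose_sub linear_compose_scale_right linear_id[unfolded id_def]) simp
    moreover have "A x \<bullet> y = x \<bullet> A y" for x y
      by (simp add: A_def inner_diff hessian_symmetric[OF assms(1)])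
    moreover have "0 \<le> A x \<bullet> x" for x
    proof -
      \<comment> \<open>The gradient inherits the constant \<open>L\<close> from
        \<open>q\<^sub>x\<close> at \<open>h = 0\<close>; this is the constant that
        \<open>\<eta>\<close> controls.\<close>
      have "L-lipschitz_on UNIV (gradient f)" using L[of 0] by (simp add: grad)
      then have "(hessian f p *v x) \<bullet> x \<le> L * (x \<bullet> x)"
        using lipschitz_derivative_inner_le hessian_works[OF assms(1)] by blast
      then have "\<eta> * ((hessian f p *v x) \<bullet> x) \<le> (\<eta> * L) * (x \<bullet> x)"
        using assms(3) by (simp add: mult.assoc)
      also have "\<dots> \<le> 1 * (x \<bullet> x)" using \<eta>L by (intro mult_right_mono) auto
      finally show ?thesis by (simp add: A_def inner_diff_left)
    qed
    moreover have "A v = (1 - \<eta> * r) *\<^sub>R v" by (simp add: A_def v(2) scaleR_diff_left)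
    moreover have "1 - \<eta> * r > 1"
      using neg assms(3) by (simp add: r_def mult_pos_neg)
    moreover have "\<exists>\<delta>>0. \<forall>\<^sub>F k in sequentially. \<forall>x\<in>cball p \<delta>. \<forall>y\<in>cball p \<delta>.
        norm (T k x - T k y - A (x - y)) \<le> \<epsilon> * norm (x - y)" if "\<epsilon> > 0" for \<epsilon>
    proof -
      \<comment> \<open>The update multiplies the linearization error of \<open>q\<^sub>x\<close> by
        \<open>\<eta>\<close>, hence the tolerance \<open>\<epsilon> / \<eta>\<close>.\<close>
      have "\<epsilon> / \<eta> > 0" using that assms(3) by simp
      from C1_partial_linearization[OF q' this, of 0 p, unfolded partial]
      obtain \<delta> where \<delta>: "\<delta> > 0" "\<And>h x y. \<lbrakk>h \<in> cball 0 \<delta>; x \<in> cball p \<delta>; y \<in> cball p \<delta>\<rbrakk> \<Longrightarrow>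
          norm (q\<^sub>x (x, h) - q\<^sub>x (y, h) - hessian f p *v (x - y)) \<le> \<epsilon> / \<eta> * norm (x - y)"
        by blast
      have "\<forall>\<^sub>F k in sequentially. H k \<in> ball 0 \<delta>"
        using \<open>H \<longlonglongrightarrow> 0\<close> \<delta>(1) by (intro topological_tendstoD) auto
      then have "\<forall>\<^sub>F k in sequentially. \<forall>x\<in>cball p \<delta>. \<forall>y\<in>cball p \<delta>.
        norm (T k x - T k y - A (x - y)) \<le> \<epsilon> * norm (x - y)"
      proof (rule eventually_mono, intro ballI)
        fix k x y assume "H k \<in> ball 0 \<delta>" and xy: "x \<in> cball p \<delta>" "y \<in> cball p \<delta>"
        then have "H k \<in> cball 0 \<delta>" by simp
        have "T k x - T k y - A (x - y) =
            - (\<eta> *\<^sub>R (q\<^sub>x (x, H k) - q\<^sub>x (y, H k) - hessian f p *v (x - y)))"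
          by (simp add: T_def A_def algebra_simps)
        then have "norm (T k x - T k y - A (x - y)) =
            \<eta> * norm (q\<^sub>x (x, H k) - q\<^sub>x (y, H k) - hessian f p *v (x - y))"
          using assms(3) by (simp only: norm_minus_cancel norm_scaleR abs_of_pos)
        also have "\<dots> \<le> \<eta> * (\<epsilon> / \<eta> * norm (x - y))"
          using \<delta>(2)[OF \<open>H k \<in> cball 0 \<delta>\<close> xy] assms(3) by (intro mult_left_mono) auto
        finally show "norm (T k x - T k y - A (x - y)) \<le> \<epsilon> * norm (x - y)"
          using assms(3) by simp
      qed
      then show ?thesis using \<delta>(1) by blast
    qed
    ultimately show "\<exists>A v a. linear A \<and> (\<forall>x y. A x \<bullet> y = x \<bullet> A y) \<and> (\<forall>x. 0 \<le> A x \<bullet> x) \<and>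
        v \<noteq> 0 \<and> A v = a *\<^sub>R v \<and> a > 1 \<and>
        (\<forall>\<epsilon>>0. \<exists>\<delta>>0. \<forall>\<^sub>F k in sequentially. \<forall>x\<in>cball p \<delta>. \<forall>y\<in>cball p \<delta>.
           norm (T k x - T k y - A (x - y)) \<le> \<epsilon> * norm (x - y))"
      using v(1) by (intro exI[of _ A] exI[of _ v] exI[of _ "1 - \<eta> * r"]) blast
  qed
  moreover have "fst ((g0 \<eta> \<beta> q\<^sub>x q\<^sub>h ^^ k) (x, h\<^sub>0)) = orbit T k x" for k x
  proof -
    have "H (Suc k) = \<beta> * q\<^sub>h (H k)" for k by (simp add: H_def)
    from g0_funpow[where H = H and q\<^sub>h = q\<^sub>h and k = k and x = x, OF this, of \<eta> q\<^sub>x]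
    have "fst ((g0 \<eta> \<beta> q\<^sub>x q\<^sub>h ^^ k) (x, H 0)) = orbit T k x"
      by (simp add: T_def[abs_def])
    then show ?thesis by (simp add: H_def)
  qed
  ultimately show ?thesis by (simp add: negligible_iff_null_sets)
qed

end
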